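(* Let $g,q,b\in\mathbb{R}$, let $n\ge 1$ be an integer, $h=x_0/n$, and let $u$ and $u^h$ be the exact solution of $(S)$ and its piecewise linear discrete approximation. Then: (a) For every grid point $(x_i,y)$ with $i=1,\dots,n+1$ and $y\in[0,y_0]$: (i) if $g>0$ then $u^h(x_i,y)\le u(x_i,y)$; (ii) if $g<0$ then $u^h(x_i,y)\ge u(x_i,y)$. (b) $\|u-u^h\|_H\le C_1 h$ and $\left\|\frac{\partial u}{\partial x}-\frac{\partial u^h}{\partial x}\right\|_H\le \widetilde{C_1}\,h$, where $C_1=x_0|g|\sqrt{\tfrac{2}{15}x_0y_0}$ and $\widetilde{C_1}=|g|\sqrt{\tfrac13 x_0y_0}$ do not depend on $h$.
   Context: Fix $x_0,y_0>0$, $\Omega=(0,x_0)\times(0,y_0)$, $\Gamma_1=\{0\}\times(0,y_0]$, $\Gamma_2=\{x_0\}\times(0,y_0]$, $\Gamma_3=[0,x_0]\times\{0,y_0\}$, and $H=L^2(\Omega)$ with its standard norm $\|\cdot\|_H$. For constants $g,q,b\in\mathbb{R}$, system $(S)$ is $-\Delta u=g$ in $\Omega$, $u=b$ on $\Gamma_1$, $-\partial u/\partial n=q$ on $\Gamma_2$, $-\partial u/\partial n=0$ on $\Gamma_3$ ($n$ the outward normal); its solution is $u(x,y)=-\tfrac12 g x^2+(gx_0-q)x+b$. For an integer $n\ge1$ put $h=x_0/n$ and $x_i=(i-1)h$, $i=1,\dots,n+1$. The discrete system $(S^h)$ is: $u^h_1=b$; $u^h_{i+1}-2u^h_i+u^h_{i-1}=-gh^2$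 for $i=2,\dots,n$; $u^h_{n+1}-u^h_n=-qh$. Its solution is $u^h_i=b+(i-1)h(gx_0-q)-h^2g\,\tfrac{i(i-1)}2$. The function $u^h$ is the piecewise linear interpolant of these nodal values: $u^h(x,y)=(gx_0-q-hgi)x+h^2g\tfrac{i(i-1)}2+b$ for $x\in[x_i,x_{i+1}]$, $y\in[0,y_0]$, $i=1,\dots,n$. Its derivative $\partial u^h/\partial x$ is the piecewise constant function defined a.e. *)

theory Defs
  imports "HOL-Analysis.Analysis"
begin

definition rect :: "real \<Rightarrow> real \<Rightarrow> (real \<times> real) set" where
  "rect x0 y0 = {0<..<x0} \<times> {0<..<y0}"

text \<open>
  Classical solutions of the mixed boundary value problem (S): \<open>u\<close> is continuously
  differentiable up to the boundary (one-sided derivatives there) and has continuous second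
  derivatives \<open>u\<^sub>x\<^sub>x\<close>, \<open>u\<^sub>y\<^sub>y\<close> inside. The normal derivative is the inner product of the gradient
  with the outward normal of the respective side; at a corner lying on two of the sides both
  conditions are imposed.
\<close>

definition solution_S ::
  "real \<Rightarrow> real \<Rightarrow> real \<Rightarrow> real \<Rightarrow> real \<Rightarrow> (real \<times> real \<Rightarrow> real) \<Rightarrow> bool" where
  "solution_S x0 y0 g q b u \<longleftrightarrow>
    (\<exists>ux uy uxx uyy.
      continuous_on ({0..x0} \<times> {0..y0}) u \<and>
      continuous_on ({0..x0} \<times> {0..y0}) ux \<and>
      continuous_on ({0..x0} \<times> {0..y0}) uy \<and>
      (\<forall>x\<in>{0..x0}. \<forall>y\<in>{0..y0}.
        ((\<lambda>s. u (s, y)) has_real_derivative ux (x, y)) (at x within {0..x0}) \<and>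
        ((\<lambda>t. u (x, t)) has_real_derivative uy (x, y)) (at y within {0..y0})) \<and>
      continuous_on (rect x0 y0) uxx \<and>
      continuous_on (rect x0 y0) uyy \<and>
      (\<forall>(x, y)\<in>rect x0 y0.
        ((\<lambda>s. ux (s, y)) has_real_derivative uxx (x, y)) (at x) \<and>
        ((\<lambda>t. uy (x, t)) has_real_derivative uyy (x, y)) (at y) \<and>
        - (uxx (x, y) + uyy (x, y)) = g) \<and>
      (\<forall>p\<in>{0} \<times> {0<..y0}. u p = b) \<and>
      (\<forall>p\<in>{x0} \<times> {0<..y0}. - ((ux p, uy p) \<bullet> (1, 0)) = q) \<and>
      (\<forall>p\<in>{0..x0} \<times> {0}. - ((ux p, uy p) \<bullet> (0, -1)) = 0) \<and>
      (\<forall>p\<in>{0..x0} \<times> {y0}. - ((ux p, uy p) \<bullet> (0, 1)) = 0))"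

definition node :: "real \<Rightarrow> nat \<Rightarrow> real" where
  "node h i = (real i - 1) * h"

definition solution_Sh ::
  "real \<Rightarrow> nat \<Rightarrow> real \<Rightarrow> real \<Rightarrow> real \<Rightarrow> (nat \<Rightarrow> real) \<Rightarrow> bool" where
  "solution_Sh h n g q b U \<longleftrightarrow>
    U 1 = b \<and>
    (\<forall>i\<in>{2..n}. U (i + 1) - 2 * U i + U (i - 1) = - g * h\<^sup>2) \<and>
    U (n + 1) - U n = - q * h"

text \<open>The interpolant is constrained on the closed rectangle only.\<close>

definition piecewise_linear_interpolant ::
  "real \<Rightarrow> nat \<Rightarrow> real \<Rightarrow> (nat \<Rightarrow> real) \<Rightarrow> (real \<times> real \<Rightarrow> real) \<Rightarrow> bool" where
  "piecewise_linear_interpolant h n y0 U v \<longleftrightarrow>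
    (\<forall>i\<in>{1..n}. \<forall>x\<in>{node h i..node h (i + 1)}. \<forall>y\<in>{0..y0}.
      v (x, y) = U i + (U (i + 1) - U i) / h * (x - node h i))"

text \<open>Where the section is not differentiable, the value is unspecified.\<close>

definition partial_x :: "(real \<times> real \<Rightarrow> real) \<Rightarrow> real \<times> real \<Rightarrow> real" where
  "partial_x f p = deriv (\<lambda>s. f (s, snd p)) (fst p)"

definition square_integrable_on :: "(real \<times> real \<Rightarrow> real) \<Rightarrow> (real \<times> real) set \<Rightarrow> bool"
    (infix "square'_integrable'_on" 50) where
  "f square_integrable_on S \<longleftrightarrow>
    f \<in> borel_measurable (lebesgue_on S) \<and> integrable (lebesgue_on S) (\<lambda>p. (f p)\<^sup>2)"

text \<open>Meaningful for square integrable \<open>f\<close> only: otherwise the integral is 0 by convention.\<close>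

definition L2_norm_on :: "(real \<times> real) set \<Rightarrow> (real \<times> real \<Rightarrow> real) \<Rightarrow> real" where
  "L2_norm_on S f = sqrt (integral\<^sup>L (lebesgue_on S) (\<lambda>p. (f p)\<^sup>2))"

text \<open>The hypotheses used for \<open>u\<close>, the nodal values and \<open>u\<^sup>h\<close> are satisfiable.\<close>

lemma solution_S_explicit:
  "solution_S x0 y0 g q b (\<lambda>(x, y). - (1/2) * g * x\<^sup>2 + (g * x0 - q) * x + b)"
  unfolding solution_S_def
  apply (rule exI[of _ "\<lambda>p. - g * fst p + (g * x0 - q)"])
  apply (rule exI[of _ "\<lambda>p. 0"])
  apply (rule exI[of _ "\<lambda>p. - g"])
  apply (rule exI[of _ "\<lambda>p. 0"])
  apply (auto simp: case_prod_unfold rect_def intro!: continuous_intros derivative_eq_intros)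
  done

lemma solution_Sh_explicit:
  assumes "n \<ge> 1" "h = x0 / real n"
  shows "solution_Sh h n g q b
    (\<lambda>i. b + (real i - 1) * h * (g * x0 - q) - h\<^sup>2 * g * (real i * (real i - 1) / 2))"
proof -
  have "x0 = real n * h" using assms by simp
  then show ?thesis
    by (auto simp: solution_Sh_def of_nat_diff field_simps power2_eq_square)
qed

lemma piecewise_linear_interpolant_exists:
  assumes "h > 0"
  shows "\<exists>v. piecewise_linear_interpolant h n y0 U v"
proof -
  define L where "L i x = U i + (U (i + 1) - U i) / h * (x - node h i)" for i x
  define k where "k x = max 1 (nat \<lceil>x / h\<rceil>)" for x :: real
  have "L (k x) x = L i x" if i: "i \<ge> 1" and x: "node h i \<le> x" "x \<le> node h (i + 1)" for i x
  proof (cases "x = node h i")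
    case True
    show ?thesis
    proof (cases "i = 1")
      case True
      then show ?thesis using \<open>x = node h i\<close> by (simp add: k_def node_def)
    next
      case False
      then obtain j where j: "i = j + 1" "j \<ge> 1" using i by (cases i) auto
      have "x / h = real j" using True j assms by (simp add: node_def)
      then have "k x = j" using j by (simp add: k_def)
      then show ?thesis using True j assms by (simp add: L_def node_def field_simps)
    qed
  next
    case False
    then have "real i - 1 < x / h" "x / h \<le> real i"
      using x assms by (auto simp: node_def field_simps)
    then have "\<lceil>x / h\<rceil> = int i" by (simp add: ceiling_eq_iff)
    then have "k x = i" using i by (simp add: k_def)
    then show ?thesis by simp
  qed
  then have "piecewise_linear_interpolant h n y0 U (\<lambda>(x, y). L (k x) x)"
    unfolding piecewise_linear_interpolant_def by (auto simp: L_def)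
  then show ?thesis by blast
qed

end

theory Submission
  imports Defs
begin

text \<open>
  The proof computes the error exactly. Two things make this possible.

  First, the given \<open>u\<close> is any classical solution, so it has to be identified with the quadratic
  \<open>- g x\<^sup>2 / 2 + (g x\<^sub>0 - q) x + b\<close>. The difference \<open>w\<close> of two solutions is harmonic with homogeneous
  mixed data, and a maximum principle makes it nonpositive: adding a small multiple of a strictly
  subharmonic quadratic whose outward derivative is negative on all three Neumann sides excludes a
  maximum in the interior and on these sides, so the maximum sits on \<open>x = 0\<close>, where \<open>w = 0\<close>
  (\<open>solution_S_homogeneous_nonpos\<close>). The strict barrier replaces Hopf's boundary lemma. Exchanging
  the two solutions gives uniqueness (\<open>solution_S_unique\<close>).

  Second, the difference scheme determines the slopes \<open>(U (i + 1) - U i) / h = g x\<^sub>0 - q - g h i\<close>: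
  the last one is prescribed and each step to the left adds \<open>g h\<close>. On a cell whose right end is
  \<open>i h\<close> the derivative of the error is therefore \<open>g (i h - x)\<close>: its sign is that of \<open>g\<close>, and the
  error, which vanishes at \<open>x = 0\<close>, has this sign too; this is part (a).

  For part (b), both errors depend on \<open>x\<close> alone inside each cell, so the squared norms are \<open>y\<^sub>0\<close> times a
  sum of one-dimensional polynomial integrals (\<open>L2_norm_rect\<close>); the vertical grid lines, where
  \<open>u\<^sup>h\<close> may fail to have a derivative, form a null set. The bound for the derivative is
  attained for every \<open>n\<close>. For the error itself the sum is
  \<open>y\<^sub>0 g\<^sup>2 h\<^sup>5 / 4\<close> times \<open>n\<^sup>3 / 3 + n\<^sup>2 / 6 + n / 30\<close>, which is at most \<open>8 n\<^sup>3 / 15\<close>, with equality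
  for \<open>n = 1\<close>.
\<close>

section \<open>Derivative tests at a maximum\<close>

lemma second_derivative_nonpos_at_max:
  fixes f :: "real \<Rightarrow> real"
  assumes f: "\<And>s. s \<in> {a<..<b} \<Longrightarrow> (f has_real_derivative f' s) (at s)"
    and f': "(f' has_real_derivative c) (at x)"
    and x: "x \<in> {a<..<b}"
    and max: "\<And>s. s \<in> {a<..<b} \<Longrightarrow> f s \<le> f x"
  shows "c \<le> 0"
proof (rule ccontr)
  assume "\<not> c \<le> 0"
  then obtain d where d: "d > 0" "\<And>k. 0 < k \<Longrightarrow> k < d \<Longrightarrow> f' x < f' (x + k)"
    using DERIV_pos_inc_right[OF f'] by auto
  have "f' x = 0"
    using x by (intro DERIV_local_max[OF f[OF x], of "min (x - a) (b - x)"]) (auto intro!: max)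
  define e where "e = min d (b - x) / 2"
  have e: "0 < e" "e < d" "x + e < b" using d x by (auto simp: e_def min_def field_simps)
  obtain z where z: "x < z" "z < x + e" "f (x + e) - f x = (x + e - x) * f' z"
    using MVT2[of x "x + e" f f'] e x f by auto
  have "f' z > 0" using d(2)[of "z - x"] z e \<open>f' x = 0\<close> by simp
  then have "f (x + e) > f x" using z e
    by (metis add_diff_cancel_left' diff_gt_0_iff_gt mult_pos_pos)
  with max[of "x + e"] e x show False by auto
qed

lemma derivative_nonpos_at_left_max:
  fixes f :: "real \<Rightarrow> real"
  assumes f: "(f has_real_derivative c) (at a within {a..b})" and "a < b"
    and max: "\<And>s. s \<in> {a..b} \<Longrightarrow> f s \<le> f a"
  shows "c \<le> 0"
proof (rule ccontr)
  assume "\<not> c \<le> 0"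
  then obtain d where d: "d > 0" "\<And>k. 0 < k \<Longrightarrow> a + k \<in> {a..b} \<Longrightarrow> k < d \<Longrightarrow> f a < f (a + k)"
    using has_real_derivative_pos_inc_right[OF f] by auto
  have "f a < f (a + min d (b - a) / 2)"
    using d(1) \<open>a < b\<close> by (intro d(2)) (auto simp: min_def field_simps)
  moreover have "f (a + min d (b - a) / 2) \<le> f a"
    using d(1) \<open>a < b\<close> by (intro max) (auto simp: min_def field_simps)
  ultimately show False by simp
qed

lemma derivative_nonneg_at_right_max:
  fixes f :: "real \<Rightarrow> real"
  assumes f: "(f has_real_derivative c) (at b within {a..b})" and "a < b"
    and max: "\<And>s. s \<in> {a..b} \<Longrightarrow> f s \<le> f b"
  shows "c \<ge> 0"
proof (rule ccontr)
  assume "\<not> c \<ge> 0"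
  then obtain d where d: "d > 0" "\<And>k. 0 < k \<Longrightarrow> b - k \<in> {a..b} \<Longrightarrow> k < d \<Longrightarrow> f b < f (b - k)"
    using has_real_derivative_neg_dec_left[OF f] by auto
  have "f b < f (b - min d (b - a) / 2)"
    using d(1) \<open>a < b\<close> by (intro d(2)) (auto simp: min_def field_simps)
  moreover have "f (b - min d (b - a) / 2) \<le> f b"
    using d(1) \<open>a < b\<close> by (intro max) (auto simp: min_def field_simps)
  ultimately show False by simp
qed

section \<open>Uniqueness for the mixed boundary value problem\<close>

lemma solution_S_E:
  assumes "solution_S x0 y0 g q b u"
  obtains ux uy uxx uyy where
    "continuous_on ({0..x0} \<times> {0..y0}) u"
    "continuous_on ({0..x0} \<times> {0..y0}) ux"
    "continuous_on ({0..x0} \<times> {0..y0}) uy"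
    "continuous_on (rect x0 y0) uxx"
    "continuous_on (rect x0 y0) uyy"
    "\<And>x y. x \<in> {0..x0} \<Longrightarrow> y \<in> {0..y0} \<Longrightarrow>
      ((\<lambda>s. u (s, y)) has_real_derivative ux (x, y)) (at x within {0..x0})"
    "\<And>x y. x \<in> {0..x0} \<Longrightarrow> y \<in> {0..y0} \<Longrightarrow>
      ((\<lambda>t. u (x, t)) has_real_derivative uy (x, y)) (at y within {0..y0})"
    "\<And>x y. (x, y) \<in> rect x0 y0 \<Longrightarrow> ((\<lambda>s. ux (s, y)) has_real_derivative uxx (x, y)) (at x)"
    "\<And>x y. (x, y) \<in> rect x0 y0 \<Longrightarrow> ((\<lambda>t. uy (x, t)) has_real_derivative uyy (x, y)) (at y)"
    "\<And>x y. (x, y) \<in> rect x0 y0 \<Longrightarrow> - (uxx (x, y) + uyy (x, y)) = g"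
    "\<And>y. y \<in> {0<..y0} \<Longrightarrow> u (0, y) = b"
    "\<And>y. y \<in> {0<..y0} \<Longrightarrow> - ux (x0, y) = q"
    "\<And>x. x \<in> {0..x0} \<Longrightarrow> uy (x, 0) = 0"
    "\<And>x. x \<in> {0..x0} \<Longrightarrow> uy (x, y0) = 0"
  using assms unfolding solution_S_def
proof (elim exE conjE, goal_cases)
  case p: (1 ux uy uxx uyy)
  note inner = p(8)[THEN bspec, of "(_, _)", unfolded prod.case]
  show ?thesis
  proof (rule that[of ux uy uxx uyy])
    show "((\<lambda>s. u (s, y)) has_real_derivative ux (x, y)) (at x within {0..x0})"
      "((\<lambda>t. u (x, t)) has_real_derivative uy (x, y)) (at y within {0..y0})"
      if "x \<in> {0..x0}" "y \<in> {0..y0}" for x y using p(5) that by blast+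
    show "u (0, y) = b" "- ux (x0, y) = q" if "y \<in> {0<..y0}" for y
      using p(9,10) that by auto
    show "uy (x, 0) = 0" "uy (x, y0) = 0" if "x \<in> {0..x0}" for x
      using p(11,12) that by auto
  qed (use p(2-4,6,7) inner in blast)+
qed

lemma solution_S_diff:
  assumes u: "solution_S x0 y0 g q b u" and v: "solution_S x0 y0 g' q' b' v"
  shows "solution_S x0 y0 (g - g') (q - q') (b - b') (\<lambda>p. u p - v p)"
proof -
  obtain ux uy uxx uyy where u:
    "continuous_on ({0..x0} \<times> {0..y0}) u"
    "continuous_on ({0..x0} \<times> {0..y0}) ux"
    "continuous_on ({0..x0} \<times> {0..y0}) uy"
    "continuous_on (rect x0 y0) uxx"
    "continuous_on (rect x0 y0) uyy"
    "\<And>x y. x \<in> {0..x0} \<Longrightarrow> y \<in> {0..y0} \<Longrightarrow>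
      ((\<lambda>s. u (s, y)) has_real_derivative ux (x, y)) (at x within {0..x0})"
    "\<And>x y. x \<in> {0..x0} \<Longrightarrow> y \<in> {0..y0} \<Longrightarrow>
      ((\<lambda>t. u (x, t)) has_real_derivative uy (x, y)) (at y within {0..y0})"
    "\<And>x y. (x, y) \<in> rect x0 y0 \<Longrightarrow> ((\<lambda>s. ux (s, y)) has_real_derivative uxx (x, y)) (at x)"
    "\<And>x y. (x, y) \<in> rect x0 y0 \<Longrightarrow> ((\<lambda>t. uy (x, t)) has_real_derivative uyy (x, y)) (at y)"
    "\<And>x y. (x, y) \<in> rect x0 y0 \<Longrightarrow> - (uxx (x, y) + uyy (x, y)) = g"
    "\<And>y. y \<in> {0<..y0} \<Longrightarrow> u (0, y) = b"
    "\<And>y. y \<in> {0<..y0} \<Longrightarrow> - ux (x0, y) = q"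
    "\<And>x. x \<in> {0..x0} \<Longrightarrow> uy (x, 0) = 0"
    "\<And>x. x \<in> {0..x0} \<Longrightarrow> uy (x, y0) = 0"
    by (rule solution_S_E[OF u]) (rule that; (assumption | blast))
  obtain vx vy vxx vyy where v:
    "continuous_on ({0..x0} \<times> {0..y0}) v"
    "continuous_on ({0..x0} \<times> {0..y0}) vx"
    "continuous_on ({0..x0} \<times> {0..y0}) vy"
    "continuous_on (rect x0 y0) vxx"
    "continuous_on (rect x0 y0) vyy"
    "\<And>x y. x \<in> {0..x0} \<Longrightarrow> y \<in> {0..y0} \<Longrightarrow>
      ((\<lambda>s. v (s, y)) has_real_derivative vx (x, y)) (at x within {0..x0})"
    "\<And>x y. x \<in> {0..x0} \<Longrightarrow> y \<in> {0..y0} \<Longrightarrow>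
      ((\<lambda>t. v (x, t)) has_real_derivative vy (x, y)) (at y within {0..y0})"
    "\<And>x y. (x, y) \<in> rect x0 y0 \<Longrightarrow> ((\<lambda>s. vx (s, y)) has_real_derivative vxx (x, y)) (at x)"
    "\<And>x y. (x, y) \<in> rect x0 y0 \<Longrightarrow> ((\<lambda>t. vy (x, t)) has_real_derivative vyy (x, y)) (at y)"
    "\<And>x y. (x, y) \<in> rect x0 y0 \<Longrightarrow> - (vxx (x, y) + vyy (x, y)) = g'"
    "\<And>y. y \<in> {0<..y0} \<Longrightarrow> v (0, y) = b'"
    "\<And>y. y \<in> {0<..y0} \<Longrightarrow> - vx (x0, y) = q'"
    "\<And>x. x \<in> {0..x0} \<Longrightarrow> vy (x, 0) = 0"
    "\<And>x. x \<in> {0..x0} \<Longrightarrow> vy (x, y0) = 0"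
    by (rule solution_S_E[OF v]) (rule that; (assumption | blast))
  have "\<forall>x\<in>{0..x0}. \<forall>y\<in>{0..y0}.
      ((\<lambda>s. u (s, y) - v (s, y)) has_real_derivative ux (x, y) - vx (x, y)) (at x within {0..x0}) \<and>
      ((\<lambda>t. u (x, t) - v (x, t)) has_real_derivative uy (x, y) - vy (x, y)) (at y within {0..y0})"
    by (intro ballI conjI DERIV_diff u(6,7) v(6,7))
  moreover have "\<forall>(x, y)\<in>rect x0 y0.
      ((\<lambda>s. ux (s, y) - vx (s, y)) has_real_derivative uxx (x, y) - vxx (x, y)) (at x) \<and>
      ((\<lambda>t. uy (x, t) - vy (x, t)) has_real_derivative uyy (x, y) - vyy (x, y)) (at y) \<and>
      - ((uxx (x, y) - vxx (x, y)) + (uyy (x, y) - vyy (x, y))) = g - g'"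
  proof (rule ballI, clarify, intro conjI)
    fix x y assume xy: "(x, y) \<in> rect x0 y0"
    show "((\<lambda>s. ux (s, y) - vx (s, y)) has_real_derivative uxx (x, y) - vxx (x, y)) (at x)"
      "((\<lambda>t. uy (x, t) - vy (x, t)) has_real_derivative uyy (x, y) - vyy (x, y)) (at y)"
      by (intro DERIV_diff u(8,9) v(8,9) xy)+
    show "- ((uxx (x, y) - vxx (x, y)) + (uyy (x, y) - vyy (x, y))) = g - g'"
      using u(10)[OF xy] v(10)[OF xy] by linarith
  qed
  moreover have "\<forall>p\<in>{0} \<times> {0<..y0}. u p - v p = b - b'"
    using u(11) v(11) by auto
  moreover have "\<forall>p\<in>{x0} \<times> {0<..y0}. - ((ux p - vx p, uy p - vy p) \<bullet> (1, 0)) = q - q'"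
    using u(12) v(12) by fastforce
  moreover have "\<forall>p\<in>{0..x0} \<times> {0}. - ((ux p - vx p, uy p - vy p) \<bullet> (0, -1)) = 0"
    "\<forall>p\<in>{0..x0} \<times> {y0}. - ((ux p - vx p, uy p - vy p) \<bullet> (0, 1)) = 0"
    using u(13,14) v(13,14) by auto
  ultimately show ?thesis
    unfolding solution_S_def
    by (intro exI[of _ "\<lambda>p. ux p - vx p"] exI[of _ "\<lambda>p. uy p - vy p"]
        exI[of _ "\<lambda>p. uxx p - vxx p"] exI[of _ "\<lambda>p. uyy p - vyy p"]
        conjI continuous_on_diff u(1-5) v(1-5))
qed

text \<open>
  The barrier \<open>2 (x - 2 x\<^sub>0)\<^sup>2 - (y - y\<^sub>0 / 2)\<^sup>2\<close> has Laplacian \<open>4 - 2 > 0\<close>; its outward derivative is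
  \<open>- 4 x\<^sub>0\<close> on the right side and \<open>- y\<^sub>0\<close> on the top and bottom sides. After adding \<open>e > 0\<close> times it to
  \<open>w\<close>, the homogeneous equation and Neumann data become strict inequalities that no maximum can satisfy.
  The horizontal sides are treated first: once they are excluded, a maximum on \<open>x = 0\<close> lies at a height
  where the Dirichlet condition, imposed for \<open>0 < y \<le> y\<^sub>0\<close>, gives the value of \<open>w\<close>.
\<close>

lemma solution_S_homogeneous_nonpos:
  assumes pos: "x0 > 0" "y0 > 0" and sol: "solution_S x0 y0 0 0 0 w"
    and xy: "x \<in> {0..x0}" "y \<in> {0..y0}"
  shows "w (x, y) \<le> 0"
proof -
  let ?R = "{0..x0} \<times> {0..y0}"
  obtain ux uy uxx uyy where cont: "continuous_on ?R w"
    and dx: "\<And>x y. x \<in> {0..x0} \<Longrightarrow> y \<in> {0..y0} \<Longrightarrow>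
      ((\<lambda>s. w (s, y)) has_real_derivative ux (x, y)) (at x within {0..x0})"
    and dy: "\<And>x y. x \<in> {0..x0} \<Longrightarrow> y \<in> {0..y0} \<Longrightarrow>
      ((\<lambda>t. w (x, t)) has_real_derivative uy (x, y)) (at y within {0..y0})"
    and dxx: "\<And>x y. (x, y) \<in> rect x0 y0 \<Longrightarrow> ((\<lambda>s. ux (s, y)) has_real_derivative uxx (x, y)) (at x)"
    and dyy: "\<And>x y. (x, y) \<in> rect x0 y0 \<Longrightarrow> ((\<lambda>t. uy (x, t)) has_real_derivative uyy (x, y)) (at y)"
    and lap: "\<And>x y. (x, y) \<in> rect x0 y0 \<Longrightarrow> - (uxx (x, y) + uyy (x, y)) = 0"
    and left: "\<And>y. y \<in> {0<..y0} \<Longrightarrow> w (0, y) = 0"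
    and right: "\<And>y. y \<in> {0<..y0} \<Longrightarrow> - ux (x0, y) = 0"
    and bottom: "\<And>x. x \<in> {0..x0} \<Longrightarrow> uy (x, 0) = 0"
    and top: "\<And>x. x \<in> {0..x0} \<Longrightarrow> uy (x, y0) = 0"
    by (rule solution_S_E[OF sol]) (rule that; (assumption | blast))
  \<comment> \<open>\<open>K\<close> bounds the value of the barrier on the left side minus its value at \<open>(x, y)\<close>.\<close>
  define K where "K = 8 * x0\<^sup>2 + y0\<^sup>2"
  have "K > 0" using pos by (simp add: K_def add_pos_pos)
  have bound: "w (x, y) \<le> e * K" if "e > 0" for e
  proof -
    define v where "v p = w p + e * (2 * (fst p - 2 * x0)\<^sup>2 - (snd p - y0 / 2)\<^sup>2)" for p
    have "continuous_on ?R v"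
      unfolding v_def using cont by (intro continuous_intros) auto
    moreover have "compact ?R" "?R \<noteq> {}" using pos by (auto intro: compact_Times)
    ultimately obtain P where "P \<in> ?R" "\<forall>p\<in>?R. v p \<le> v P"
      using continuous_attains_sup by blast
    then obtain X Y where XY: "X \<in> {0..x0}" "Y \<in> {0..y0}"
      and max: "\<And>s t. s \<in> {0..x0} \<Longrightarrow> t \<in> {0..y0} \<Longrightarrow> v (s, t) \<le> v (X, Y)" by auto
    have vx: "((\<lambda>s. v (s, t)) has_real_derivative ux (s, t) + e * (4 * (s - 2 * x0)))
        (at s within {0..x0})" if "s \<in> {0..x0}" "t \<in> {0..y0}" for s t
      unfolding v_def by (rule derivative_eq_intros dx that refl | simp)+
    have vy: "((\<lambda>t. v (s, t)) has_real_derivative uy (s, t) - e * (2 * (t - y0 / 2)))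
        (at t within {0..y0})" if "s \<in> {0..x0}" "t \<in> {0..y0}" for s t
      unfolding v_def by (rule derivative_eq_intros dy that refl | simp add: algebra_simps)+
    have "Y \<noteq> 0"
      using derivative_nonpos_at_left_max[of "\<lambda>t. v (X, t)" _ 0 y0, OF vy] XY pos max bottom that
      by (auto simp: mult_le_0_iff)
    moreover have "Y \<noteq> y0"
      using derivative_nonneg_at_right_max[of "\<lambda>t. v (X, t)" _ y0 0, OF vy] XY pos max top that
      by (auto simp: zero_le_mult_iff mult_le_0_iff)
    ultimately have Y: "Y \<in> {0<..<y0}" using XY by auto
    have "X \<noteq> x0"
      using derivative_nonneg_at_right_max[of "\<lambda>s. v (s, Y)" _ x0 0, OF vx] XY pos max right Y that
      by (auto simp: zero_le_mult_iff mult_le_0_iff)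
    moreover have "\<not> X \<in> {0<..<x0}"
    proof
      assume X: "X \<in> {0<..<x0}"
      have at: "at s within {0..c} = at s" if "s \<in> {0<..<c}" for s c :: real
        using that by (simp add: at_within_Icc_at)
      have R: "(X, Y) \<in> rect x0 y0" using X Y by (simp add: rect_def)
      have "uxx (X, Y) + e * 4 \<le> 0"
      proof (rule second_derivative_nonpos_at_max)
        show "((\<lambda>s. v (s, Y)) has_real_derivative ux (s, Y) + e * (4 * (s - 2 * x0))) (at s)"
          if "s \<in> {0<..<x0}" for s using vx[of s Y] that XY by (simp add: at)
        show "((\<lambda>s. ux (s, Y) + e * (4 * (s - 2 * x0))) has_real_derivative uxx (X, Y) + e * 4) (at X)"
          by (rule derivative_eq_intros dxx R refl | simp)+
      qed (use X XY max in auto)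
      moreover have "uyy (X, Y) - e * 2 \<le> 0"
      proof (rule second_derivative_nonpos_at_max)
        show "((\<lambda>t. v (X, t)) has_real_derivative uy (X, t) - e * (2 * (t - y0 / 2))) (at t)"
          if "t \<in> {0<..<y0}" for t using vy[of X t] that XY by (simp add: at)
        show "((\<lambda>t. uy (X, t) - e * (2 * (t - y0 / 2))) has_real_derivative uyy (X, Y) - e * 2) (at Y)"
          by (rule derivative_eq_intros dyy R refl | simp)+
      qed (use Y XY max in auto)
      ultimately show False using lap[OF R] \<open>e > 0\<close> by simp
    qed
    ultimately have "X = 0" using XY by auto
    then have "v (X, Y) = e * (8 * x0\<^sup>2 - (Y - y0 / 2)\<^sup>2)"
      using left Y by (simp add: v_def power_mult_distrib)
    also have "\<dots> \<le> e * (8 * x0\<^sup>2)"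
      using \<open>e > 0\<close> by (intro mult_left_mono) auto
    finally have "v (X, Y) \<le> e * (8 * x0\<^sup>2)" .
    then have "w (x, y) + e * (2 * (x - 2 * x0)\<^sup>2 - (y - y0 / 2)\<^sup>2) \<le> e * (8 * x0\<^sup>2)"
      using max[OF xy] by (simp add: v_def)
    moreover have "(y - y0 / 2)\<^sup>2 \<le> y0\<^sup>2"
      using xy pos by (intro abs_le_square_iff[THEN iffD1]) auto
    then have "e * (8 * x0\<^sup>2 - (2 * (x - 2 * x0)\<^sup>2 - (y - y0 / 2)\<^sup>2)) \<le> e * K"
      using \<open>e > 0\<close> unfolding K_def by (intro mult_left_mono) (smt (verit) zero_le_power2, simp)
    ultimately show ?thesis by (simp add: algebra_simps)
  qed
  show ?thesis
  proof (rule field_le_epsilon)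
    fix d :: real assume "d > 0"
    then show "w (x, y) \<le> 0 + d" using bound[of "d / K"] \<open>K > 0\<close> by simp
  qed
qed

lemma solution_S_unique:
  assumes pos: "x0 > 0" "y0 > 0"
    and u: "solution_S x0 y0 g q b u" and v: "solution_S x0 y0 g q b v"
    and xy: "x \<in> {0..x0}" "y \<in> {0..y0}"
  shows "u (x, y) = v (x, y)"
  using solution_S_homogeneous_nonpos[OF pos _ xy, of "\<lambda>p. u p - v p"]
    solution_S_homogeneous_nonpos[OF pos _ xy, of "\<lambda>p. v p - u p"]
    solution_S_diff[OF u v] solution_S_diff[OF v u]
  by simp

section \<open>The discrete solution and the pointwise error\<close>

lemma node_Suc: "node h (Suc i) = node h i + h"
  by (simp add: node_def algebra_simps)

text \<open>
  The scheme fixes the second differences and the last first difference, so the first differences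
  are found by induction downwards from \<open>i = n\<close>.
\<close>

lemma solution_Sh_diff:
  assumes "h = x0 / real n" and sol: "solution_Sh h n g q b U" and "i \<in> {1..n}"
  shows "U (Suc i) - U i = h * (g * x0 - q - g * h * real i)"
proof -
  have "1 \<le> i" "i \<le> n" using assms by auto
  have x0: "x0 = h * real n" using assms by auto
  from \<open>i \<le> n\<close> \<open>1 \<le> i\<close> show ?thesis
  proof (induction rule: inc_induct)
    case base
    then show ?case using sol by (simp add: solution_Sh_def x0 algebra_simps)
  next
    case (step k)
    then have "Suc k \<in> {2..n}" by auto
    then have "U (Suc k + 1) - 2 * U (Suc k) + U (Suc k - 1) = - g * h\<^sup>2"
      using sol unfolding solution_Sh_def by blast
    then show ?case using step by (simp add: algebra_simps power2_eq_square)
  qed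
qed

lemma solution_Sh_nodal:
  assumes "h = x0 / real n" and sol: "solution_Sh h n g q b U" and "i \<in> {1..Suc n}"
  shows "U i = b + (real i - 1) * h * (g * x0 - q) - h\<^sup>2 * g * (real i * (real i - 1) / 2)"
proof -
  have "1 \<le> i" "i \<le> Suc n" using assms by auto
  then show ?thesis
  proof (induction rule: dec_induct)
    case base
    then show ?case using sol by (simp add: solution_Sh_def)
  next
    case (step k)
    then show ?case using solution_Sh_diff[OF assms(1,2), of k]
      by (simp add: field_simps power2_eq_square)
  qed
qed

lemma interpolant_eq:
  assumes "h > 0" and h: "h = x0 / real n" and sol: "solution_Sh h n g q b U"
    and int: "piecewise_linear_interpolant h n y0 U v"
    and i: "i \<in> {1..n}" and xy: "x \<in> {node h i..node h (Suc i)}" "y \<in> {0..y0}"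
  shows "v (x, y) = (g * x0 - q - h * g * real i) * x + h\<^sup>2 * g * (real i * (real i - 1) / 2) + b"
proof -
  have "v (x, y) = U i + (U (Suc i) - U i) / h * (x - node h i)"
    using int i xy unfolding piecewise_linear_interpolant_def by (metis Suc_eq_plus1)
  also have "(U (Suc i) - U i) / h = g * x0 - q - g * h * real i"
    using solution_Sh_diff[OF h sol i] \<open>h > 0\<close> by simp
  also have "U i = b + (real i - 1) * h * (g * x0 - q) - h\<^sup>2 * g * (real i * (real i - 1) / 2)"
    using solution_Sh_nodal[OF h sol] i by simp
  finally show ?thesis
    by (simp add: node_def field_simps power2_eq_square)
qed

text \<open>
  In the local coordinate \<open>s\<close> of a cell the slopes of the two functions differ by \<open>g (h - s)\<close>, and at
  the left node the values differ by \<open>g r h\<^sup>2 / 2\<close>, where \<open>r\<close> is the number of cells already passed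
  (so \<open>r h\<close> is the left node and \<open>r + 1\<close> the index of the cell).
\<close>

lemma exact_minus_interpolant:
  fixes g h q b x0 s r :: real
  assumes "x = r * h + s"
  shows "(- (1/2) * g * x\<^sup>2 + (g * x0 - q) * x + b) -
     ((g * x0 - q - h * g * (r + 1)) * x + h\<^sup>2 * g * ((r + 1) * r / 2) + b)
    = g / 2 * (r * h\<^sup>2 + 2 * h * s - s\<^sup>2)"
  unfolding assms by (simp add: field_simps power2_eq_square)

section \<open>Integrals over the rectangle, cell by cell\<close>

definition cell :: "real \<Rightarrow> real \<Rightarrow> nat \<Rightarrow> (real \<times> real) set" where
  "cell y0 h i = {node h i<..<node h (Suc i)} \<times> {0<..<y0}"

lemma cell_eq_box: "cell y0 h i = box (node h i, 0) (node h (Suc i), y0)"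
  by (auto simp: cell_def box_def Basis_prod_def)

lemma ex_node_interval:
  assumes "h > 0" "h = x0 / real n" "x \<in> {0<..<x0}"
  obtains i where "i \<in> {1..n}" "node h i < x" "x \<le> node h (Suc i)"
proof
  let ?i = "nat \<lceil>x / h\<rceil>"
  have "x0 = real n * h" using assms by (cases "n = 0") auto
  then have x: "x / h > 0" "x / h < real n" using assms(1,3) by (auto simp: field_simps)
  then show "?i \<in> {1..n}" by (simp add: le_nat_iff nat_le_iff ceiling_le_iff le_ceiling_iff)
  have "real ?i - 1 < x / h" "x / h \<le> real ?i" using x by linarith+
  then show "node h ?i < x" "x \<le> node h (Suc ?i)"
    using assms(1) by (auto simp: node_def field_simps)
qed

lemma rect_minus_cells_negligible:
  assumes "h > 0" "h = x0 / real n"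
  shows "negligible (rect x0 y0 - (\<Union>i\<in>{1..n}. cell y0 h i))"
proof (rule negligible_subset)
  show "negligible (\<Union>i\<in>{1..n}. {p. (1, 0) \<bullet> (p :: real \<times> real) = node h (Suc i)})"
    by (intro negligible_Union) (auto intro!: negligible_hyperplane simp: zero_prod_def)
  show "rect x0 y0 - (\<Union>i\<in>{1..n}. cell y0 h i)
      \<subseteq> (\<Union>i\<in>{1..n}. {p. (1, 0) \<bullet> p = node h (Suc i)})"
  proof
    fix p assume p: "p \<in> rect x0 y0 - (\<Union>i\<in>{1..n}. cell y0 h i)"
    then have "fst p \<in> {0<..<x0}" by (auto simp: rect_def)
    then obtain i where "i \<in> {1..n}" "node h i < fst p" "fst p \<le> node h (Suc i)"
      using ex_node_interval assms by metis
    then show "p \<in> (\<Union>i\<in>{1..n}. {p. (1, 0) \<bullet> p = node h (Suc i)})"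
      using p by (cases p) (force simp: cell_def rect_def)
  qed
qed

lemma cells_subset_rect:
  assumes "h > 0" "h = x0 / real n"
  shows "(\<Union>i\<in>{1..n}. cell y0 h i) \<subseteq> rect x0 y0"
proof -
  have x0: "x0 = real n * h" using assms by (cases "n = 0") auto
  have "node h i \<ge> 0" "node h (Suc i) \<le> x0" if "i \<in> {1..n}" for i
    using that assms(1) x0 by (auto simp: node_def)
  then show ?thesis by (force simp: cell_def rect_def)
qed

lemma cells_disjoint:
  assumes "h > 0" "i \<noteq> j"
  shows "cell y0 h i \<inter> cell y0 h j = {}"
proof -
  have *: "node h (Suc k) \<le> node h l" if "k < l" for k l
    using that assms(1) by (simp add: node_def)
  show ?thesis using *[of i j] *[of j i] assms(2)
    by (cases "i < j") (auto simp: cell_def dest: less_trans less_le_trans)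
qed

lemma integral_cell:
  assumes "y0 > 0" "h > 0" and \<phi>: "continuous_on {node h i..node h (Suc i)} \<phi>"
    and c: "(\<phi> has_integral c) {node h i..node h (Suc i)}"
    and F: "\<And>x y. (x, y) \<in> cell y0 h i \<Longrightarrow> F (x, y) = (\<phi> x :: real)"
  shows "F absolutely_integrable_on cell y0 h i" "(F has_integral y0 * c) (cell y0 h i)"
proof -
  let ?C = "cbox (node h i, 0) (node h (Suc i), y0)"
  let ?f = "\<lambda>p :: real \<times> real. \<phi> (fst p)"
  have cont: "continuous_on ?C ?f"
    by (rule continuous_on_compose2[OF \<phi>]) (auto intro!: continuous_intros)
  have "integral ?C ?f = integral {node h i..node h (Suc i)} (\<lambda>x. integral {0..y0} (\<lambda>y. \<phi> x))"
    using integral_prod_continuous[OF cont] by simp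
  also have "\<dots> = y0 * c"
    using assms(1) integral_unique[OF c] by simp
  finally have "(?f has_integral y0 * c) ?C"
    using integrable_continuous[OF cont] by (metis integrable_integral)
  then have "(?f has_integral y0 * c) (cell y0 h i)"
    by (simp add: cell_eq_box has_integral_open_interval)
  then show "(F has_integral y0 * c) (cell y0 h i)"
    by (rule has_integral_eq[rotated]) (auto simp: F)
  have "?f absolutely_integrable_on cell y0 h i"
    using absolutely_integrable_continuous[OF cont]
    by (simp add: cell_eq_box absolutely_integrable_on_open_interval)
  then show "F absolutely_integrable_on cell y0 h i"
    by (rule absolutely_integrable_spike[where S = "{}"]) (auto simp: F)
qed

text \<open>
  The cells are disjoint and fill the rectangle up to the grid lines. These lines are null, so the
  values of \<open>F\<close> on them, arbitrary where a derivative does not exist, do not affect the integral.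
\<close>

lemma integral_rect:
  assumes "y0 > 0" "h > 0" "h = x0 / real n"
    and \<phi>: "\<And>i. i \<in> {1..n} \<Longrightarrow> continuous_on {node h i..node h (Suc i)} (\<phi> i)"
    and c: "\<And>i. i \<in> {1..n} \<Longrightarrow> (\<phi> i has_integral c i) {node h i..node h (Suc i)}"
    and F: "\<And>i x y. i \<in> {1..n} \<Longrightarrow> (x, y) \<in> cell y0 h i \<Longrightarrow> F (x, y) = (\<phi> i x :: real)"
  shows "integrable (lebesgue_on (rect x0 y0)) F"
    "integral\<^sup>L (lebesgue_on (rect x0 y0)) F = y0 * (\<Sum>i=1..n. c i)"
proof -
  let ?U = "\<Union>i\<in>{1..n}. cell y0 h i"
  note cellF = integral_cell[OF assms(1,2) \<phi> c F]
  have spike: "negligible {p \<in> ?U - rect x0 y0. F p \<noteq> 0}"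
      "negligible {p \<in> rect x0 y0 - ?U. F p \<noteq> 0}"
    using cells_subset_rect[OF assms(2,3)] rect_minus_cells_negligible[OF assms(2,3), of y0]
    by (auto intro: negligible_subset simp: Diff_eq_empty_iff[THEN iffD2])
  have "F absolutely_integrable_on (\<Union>i\<in>I. cell y0 h i)" if "I \<subseteq> {1..n}" for I
    using finite_subset[OF that finite_atLeastAtMost] that
    by (induction I rule: finite_induct) (auto intro!: absolutely_integrable_Un cellF)
  then have "F absolutely_integrable_on rect x0 y0"
    using absolutely_integrable_spike_set spike by blast
  moreover have meas: "rect x0 y0 \<in> sets lebesgue"
    by (simp add: rect_def borel_open open_Times)
  ultimately show int: "integrable (lebesgue_on (rect x0 y0)) F"
    by (rule absolutely_integrable_imp_integrable)
  have "(F has_integral (\<Sum>i\<in>{1..n}. y0 * c i)) ?U"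
    by (rule has_integral_UN) (auto intro!: cellF simp: pairwise_def cells_disjoint[OF assms(2)])
  then have "(F has_integral (\<Sum>i\<in>{1..n}. y0 * c i)) (rect x0 y0)"
    using has_integral_spike_set_eq[OF spike] by blast
  then show "integral\<^sup>L (lebesgue_on (rect x0 y0)) F = y0 * (\<Sum>i=1..n. c i)"
    using lebesgue_integral_eq_integral[OF int meas] by (simp add: integral_unique sum_distrib_left)
qed

lemma L2_norm_rect:
  assumes "y0 > 0" "h > 0" "h = x0 / real n"
    and \<phi>: "\<And>i. i \<in> {1..n} \<Longrightarrow> continuous_on {node h i..node h (Suc i)} (\<phi> i)"
    and c: "\<And>i. i \<in> {1..n} \<Longrightarrow> ((\<lambda>x. (\<phi> i x)\<^sup>2) has_integral c i) {node h i..node h (Suc i)}"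
    and F: "\<And>i x y. i \<in> {1..n} \<Longrightarrow> (x, y) \<in> cell y0 h i \<Longrightarrow> F (x, y) = (\<phi> i x :: real)"
  shows "F square_integrable_on rect x0 y0"
    "L2_norm_on (rect x0 y0) F = sqrt (y0 * (\<Sum>i=1..n. c i))"
proof -
  have "integrable (lebesgue_on (rect x0 y0)) F"
    by (rule integral_rect(1)[OF assms(1-3) \<phi> integrable_integral F])
      (auto intro!: integrable_continuous_interval \<phi>)
  moreover have "integrable (lebesgue_on (rect x0 y0)) (\<lambda>p. (F p)\<^sup>2)"
    "integral\<^sup>L (lebesgue_on (rect x0 y0)) (\<lambda>p. (F p)\<^sup>2) = y0 * (\<Sum>i=1..n. c i)"
    by (rule integral_rect[OF assms(1-3) _ c]; auto intro!: continuous_intros \<phi> simp: F)+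
  ultimately show "F square_integrable_on rect x0 y0"
    "L2_norm_on (rect x0 y0) F = sqrt (y0 * (\<Sum>i=1..n. c i))"
    by (auto simp: square_integrable_on_def L2_norm_on_def)
qed

section \<open>The integrals and sums for the two errors\<close>

lemma has_integral_error:
  fixes g h r a :: real
  assumes "h > 0"
  shows "((\<lambda>x. (g / 2 * (r * h\<^sup>2 + 2 * h * (x - a) - (x - a)\<^sup>2))\<^sup>2) has_integral
    g\<^sup>2 * h ^ 5 / 4 * (r\<^sup>2 + 4 * r / 3 + 8 / 15)) {a..a + h}"
proof -
  \<comment> \<open>the square expanded in powers of \<open>x - a\<close> and integrated term by term\<close>
  define A where "A x = g\<^sup>2 / 4 * (r\<^sup>2 * h ^ 4 * (x - a) + 2 * r * h ^ 3 * (x - a)\<^sup>2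
      + (4 - 2 * r) / 3 * h\<^sup>2 * (x - a) ^ 3 - h * (x - a) ^ 4 + 1 / 5 * (x - a) ^ 5)" for x
  have "((\<lambda>x. (g / 2 * (r * h\<^sup>2 + 2 * h * (x - a) - (x - a)\<^sup>2))\<^sup>2) has_integral A (a + h) - A a)
      {a..a + h}"
  proof (rule fundamental_theorem_of_calculus)
    fix x
    have "(A has_real_derivative (g / 2 * (r * h\<^sup>2 + 2 * h * (x - a) - (x - a)\<^sup>2))\<^sup>2) (at x)"
      unfolding A_def
      by (rule derivative_eq_intros refl)+ (simp add: field_simps eval_nat_numeral)
    then show "(A has_vector_derivative (g / 2 * (r * h\<^sup>2 + 2 * h * (x - a) - (x - a)\<^sup>2))\<^sup>2)
        (at x within {a..a + h})"
      by (simp add: has_real_derivative_iff_has_vector_derivative has_vector_derivative_at_within)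
  qed (use assms in simp)
  moreover have "A (a + h) - A a = g\<^sup>2 * h ^ 5 / 4 * (r\<^sup>2 + 4 * r / 3 + 8 / 15)"
    by (simp add: A_def field_simps eval_nat_numeral)
  ultimately show ?thesis by simp
qed

lemma has_integral_derivative_error:
  fixes g h a :: real
  assumes "h > 0"
  shows "((\<lambda>x. (g * (a + h - x))\<^sup>2) has_integral g\<^sup>2 * h ^ 3 / 3) {a..a + h}"
proof -
  define A where "A x = - (g\<^sup>2 / 3 * (a + h - x) ^ 3)" for x
  have "((\<lambda>x. (g * (a + h - x))\<^sup>2) has_integral A (a + h) - A a) {a..a + h}"
  proof (rule fundamental_theorem_of_calculus)
    fix x
    have "(A has_real_derivative (g * (a + h - x))\<^sup>2) (at x)"
      unfolding A_def by (rule derivative_eq_intros refl)+ (simp add: power_mult_distrib)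
    then show "(A has_vector_derivative (g * (a + h - x))\<^sup>2) (at x within {a..a + h})"
      by (simp add: has_real_derivative_iff_has_vector_derivative has_vector_derivative_at_within)
  qed (use assms in simp)
  then show ?thesis by (simp add: A_def)
qed

lemma sum_error:
  "(\<Sum>i=1..n. (real i - 1)\<^sup>2 + 4 * (real i - 1) / 3 + 8 / 15)
    = real n ^ 3 / 3 + (real n)\<^sup>2 / 6 + real n / 30"
  by (induction n) (simp_all add: field_simps eval_nat_numeral)

lemma error_sum_bound:
  assumes "n \<ge> 1"
  shows "real n ^ 3 / 3 + (real n)\<^sup>2 / 6 + real n / 30 \<le> 8 / 15 * real n ^ 3"
proof -
  have "real n \<le> real n ^ 3" "(real n)\<^sup>2 \<le> real n ^ 3"
    using assms by (auto intro: self_le_power power_increasing)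
  then show ?thesis by linarith
qed

section \<open>The error estimates\<close>

lemma deriv_eq_on_open:
  assumes "open S" "x \<in> S" "\<And>s. s \<in> S \<Longrightarrow> f s = k s" "(k has_field_derivative D) (at x)"
  shows "deriv f x = D"
  using assms by (intro DERIV_imp_deriv has_field_derivative_transform_within_open[of k D x S f]) auto

theorem lemma1:
  fixes x0 y0 g q b h :: real and n :: nat
    and u uh :: "real \<times> real \<Rightarrow> real" and U :: "nat \<Rightarrow> real"
  assumes "x0 > 0" and "y0 > 0" and "n \<ge> 1" and "h = x0 / real n"
    and "solution_S x0 y0 g q b u"
    and "solution_Sh h n g q b U"
    and "piecewise_linear_interpolant h n y0 U uh"
  shows "(\<forall>i\<in>{1..n + 1}. \<forall>y\<in>{0..y0}.
            (g > 0 \<longrightarrow> uh (node h i, y) \<le> u (node h i, y)) \<and>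
            (g < 0 \<longrightarrow> uh (node h i, y) \<ge> u (node h i, y))) \<and>
         (\<lambda>p. u p - uh p) square_integrable_on rect x0 y0 \<and>
         L2_norm_on (rect x0 y0) (\<lambda>p. u p - uh p)
           \<le> x0 * \<bar>g\<bar> * sqrt (2 / 15 * x0 * y0) * h \<and>
         (\<lambda>p. partial_x u p - partial_x uh p) square_integrable_on rect x0 y0 \<and>
         L2_norm_on (rect x0 y0) (\<lambda>p. partial_x u p - partial_x uh p)
           \<le> \<bar>g\<bar> * sqrt (1 / 3 * x0 * y0) * h"
proof -
  have h: "h > 0" using assms(1,3,4) by auto
  have x0: "x0 = real n * h" using assms(3,4) by simp
  define E where
    "E i x = g / 2 * ((real i - 1) * h\<^sup>2 + 2 * h * (x - node h i) - (x - node h i)\<^sup>2)" for i x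
  have interval: "{node h i..node h (Suc i)} \<subseteq> {0..x0}" if "i \<in> {1..n}" for i
    using that h x0 by (auto simp: node_def intro: order_trans)
  have u: "u (x, y) = - (1/2) * g * x\<^sup>2 + (g * x0 - q) * x + b"
    if "x \<in> {0..x0}" "y \<in> {0..y0}" for x y
    using solution_S_unique[OF assms(1,2,5) solution_S_explicit that] by simp
  note uh = interpolant_eq[OF h assms(4,6,7)]
  have error: "u (x, y) - uh (x, y) = E i x"
    if "i \<in> {1..n}" "x \<in> {node h i..node h (Suc i)}" "y \<in> {0..y0}" for i x y
  proof -
    have "x \<in> {0..x0}" using interval that by blast
    moreover have "x = (real i - 1) * h + (x - node h i)" by (simp add: node_def)
    ultimately show ?thesis
      using exact_minus_interpolant[of x "real i - 1" h "x - node h i" g x0 q b] that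
      by (simp add: u uh E_def)
  qed

  have nodal: "u (node h i, y) - uh (node h i, y) = g * (h\<^sup>2 * (real i - 1) / 2)"
    if "i \<in> {1..n + 1}" "y \<in> {0..y0}" for i y
    \<comment> \<open>every node but the last is the left end of a cell; the last is the right end of cell \<open>n\<close>\<close>
  proof (cases "i \<le> n")
    case True
    then have "u (node h i, y) - uh (node h i, y) = E i (node h i)"
      using that h by (intro error) (auto simp: node_Suc)
    then show ?thesis by (simp add: E_def)
  next
    case False
    then have i: "i = Suc n" using that by simp
    have "u (node h i, y) - uh (node h i, y) = E n (node h i)"
      using that h assms(3) unfolding i by (intro error) (auto simp: node_Suc)
    then show ?thesis by (simp add: E_def i node_Suc field_simps power2_eq_square)
  qed
  have below: "uh (node h i, y) \<le> u (node h i, y)" if "g > 0" "i \<in> {1..n + 1}" "y \<in> {0..y0}" for i y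
  proof -
    have "g * (h\<^sup>2 * (real i - 1) / 2) \<ge> 0" using that by simp
    then show ?thesis using nodal[OF that(2,3)] by linarith
  qed
  have above: "uh (node h i, y) \<ge> u (node h i, y)"
    if "g < 0" "i \<in> {1..n + 1}" "y \<in> {0..y0}" for i y
  proof -
    have "g * (h\<^sup>2 * (real i - 1) / 2) \<le> 0" using that by (intro mult_nonpos_nonneg) auto
    then show ?thesis using nodal[OF that(2,3)] by linarith
  qed
  have cont_E: "continuous_on {node h i..node h (Suc i)} (E i)" for i
    unfolding E_def by (intro continuous_intros)
  have int_E: "((\<lambda>x. (E i x)\<^sup>2) has_integral
      g\<^sup>2 * h ^ 5 / 4 * ((real i - 1)\<^sup>2 + 4 * (real i - 1) / 3 + 8 / 15))
      {node h i..node h (Suc i)}" for i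
    unfolding E_def node_Suc using h by (rule has_integral_error)
  have cell_E: "u (x, y) - uh (x, y) = E i x" if "i \<in> {1..n}" "(x, y) \<in> cell y0 h i" for i x y
    using that by (intro error) (auto simp: cell_def)
  have L2_error: "(\<lambda>p. u p - uh p) square_integrable_on rect x0 y0"
    "L2_norm_on (rect x0 y0) (\<lambda>p. u p - uh p) = sqrt (y0 * (\<Sum>i=1..n.
      g\<^sup>2 * h ^ 5 / 4 * ((real i - 1)\<^sup>2 + 4 * (real i - 1) / 3 + 8 / 15)))"
    by (rule L2_norm_rect[OF assms(2) h assms(4) cont_E int_E cell_E]; assumption)+
  have norm_error: "L2_norm_on (rect x0 y0) (\<lambda>p. u p - uh p)
      \<le> x0 * \<bar>g\<bar> * sqrt (2 / 15 * x0 * y0) * h"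
  proof -
    have "y0 * (\<Sum>i=1..n. g\<^sup>2 * h ^ 5 / 4 * ((real i - 1)\<^sup>2 + 4 * (real i - 1) / 3 + 8 / 15))
        = y0 * g\<^sup>2 * h ^ 5 / 4 * (real n ^ 3 / 3 + (real n)\<^sup>2 / 6 + real n / 30)"
      by (simp only: sum_distrib_left[symmetric] sum_error) simp
    also have "\<dots> \<le> y0 * g\<^sup>2 * h ^ 5 / 4 * (8 / 15 * real n ^ 3)"
      using error_sum_bound[OF assms(3)] assms(2) h by (intro mult_left_mono) auto
    also have "\<dots> = (x0 * \<bar>g\<bar> * h)\<^sup>2 * (2 / 15 * x0 * y0)"
      unfolding x0 by (simp add: power_mult_distrib eval_nat_numeral)
    finally have "L2_norm_on (rect x0 y0) (\<lambda>p. u p - uh p)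
        \<le> sqrt ((x0 * \<bar>g\<bar> * h)\<^sup>2 * (2 / 15 * x0 * y0))"
      unfolding L2_error(2) by (rule real_sqrt_le_mono)
    also have "\<dots> = x0 * \<bar>g\<bar> * h * sqrt (2 / 15 * x0 * y0)"
      using assms(1) h by (simp only: real_sqrt_mult real_sqrt_abs) (simp add: abs_mult)
    finally show ?thesis by (simp add: mult_ac)
  qed
  have cont_D: "continuous_on {node h i..node h (Suc i)} (\<lambda>x. g * (node h i + h - x))" for i
    by (intro continuous_intros)
  have int_D: "((\<lambda>x. (g * (node h i + h - x))\<^sup>2) has_integral g\<^sup>2 * h ^ 3 / 3)
      {node h i..node h (Suc i)}" for i
    unfolding node_Suc using h by (rule has_integral_derivative_error)
  have cell_D: "partial_x u (x, y) - partial_x uh (x, y) = g * (node h i + h - x)"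
    if "i \<in> {1..n}" "(x, y) \<in> cell y0 h i" for i x y
  proof -
    have x: "x \<in> {node h i<..<node h (Suc i)}" and y: "y \<in> {0..y0}"
      using that(2) by (auto simp: cell_def)
    have "deriv (\<lambda>s. u (s, y)) x = - g * x + (g * x0 - q)"
    proof (rule deriv_eq_on_open[OF open_greaterThanLessThan x])
      show "u (s, y) = - (1/2) * g * s\<^sup>2 + (g * x0 - q) * s + b"
        if "s \<in> {node h i<..<node h (Suc i)}" for s
        using interval[OF \<open>i \<in> {1..n}\<close>] that y by (intro u) auto
    qed (auto intro!: derivative_eq_intros)
    moreover have "deriv (\<lambda>s. uh (s, y)) x = g * x0 - q - h * g * real i"
    proof (rule deriv_eq_on_open[OF open_greaterThanLessThan x])
      show "uh (s, y) = (g * x0 - q - h * g * real i) * s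
          + h\<^sup>2 * g * (real i * (real i - 1) / 2) + b"
        if "s \<in> {node h i<..<node h (Suc i)}" for s
        using that y \<open>i \<in> {1..n}\<close> by (intro uh) auto
    qed (auto intro!: derivative_eq_intros)
    ultimately show ?thesis
      by (simp add: partial_x_def node_def algebra_simps)
  qed
  have L2_derivative_error:
    "(\<lambda>p. partial_x u p - partial_x uh p) square_integrable_on rect x0 y0"
    "L2_norm_on (rect x0 y0) (\<lambda>p. partial_x u p - partial_x uh p)
      = sqrt (y0 * (\<Sum>i=1..n. g\<^sup>2 * h ^ 3 / 3))"
    by (rule L2_norm_rect[OF assms(2) h assms(4) cont_D int_D cell_D]; assumption)+
  have norm_derivative_error: "L2_norm_on (rect x0 y0) (\<lambda>p. partial_x u p - partial_x uh p)
      \<le> \<bar>g\<bar> * sqrt (1 / 3 * x0 * y0) * h"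
  proof -
    have "y0 * (\<Sum>i=1..n. g\<^sup>2 * h ^ 3 / 3) = (\<bar>g\<bar> * h)\<^sup>2 * (1 / 3 * x0 * y0)"
      unfolding x0 by (simp add: power_mult_distrib eval_nat_numeral)
    then have "L2_norm_on (rect x0 y0) (\<lambda>p. partial_x u p - partial_x uh p)
        = \<bar>g\<bar> * h * sqrt (1 / 3 * x0 * y0)"
      unfolding L2_derivative_error(2) using h by (simp only: real_sqrt_mult real_sqrt_abs) (simp add: abs_mult)
    then show ?thesis by (simp add: mult_ac)
  qed
  show ?thesis
    by (intro conjI ballI impI below above L2_error(1) norm_error
        L2_derivative_error(1) norm_derivative_error)
qed

end
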